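(* Let $G$ be a topological rough group with rough identity element $e$ such that $G$ (with the topology $\tau_G$) is a $T_0$-space. If $e\in G$, then for each $g\in G\setminus\{e\}$ the point $e$ does not belong to the closure of $\{g\}$ in $G$.
   Context: An approximation space $(U,R)$ is a non-empty set $U$ with an equivalence relation $R$; for $X\subset U$ the upper approximation is $\overline{X}=\{x\in U:[x]_R\cap X\neq\emptyset\}$, where $[x]_R$ is the equivalence class of $x$. Let $U$ carry a binary operation, written $xy$. A subset $G\subset U$ is a rough group if: (1) $xy\in\overline{G}$ for all $x,y\in G$; (2) $(xy)z=x(yz)$ for all $x,y,z\in\overline{G}$; (3) there is $e\in\overline{G}$ (the rough identity element) with $ex=xe=x$ for all $x\in\overline{G}$; (4) for every $x\in G$ there is $y\in G$ with $xy=yx=e$ (written $y=x^{-1}$). A topological rough group is a rough group $G$ together with a topology $\tau$ on $\overline{G}$ such that, with $\tau_G$ the subspace topology on $G$, the multiplication $G\times G\to\overline{G}$, $(x,y)\mapsto xy$, is continuous (product topology of $\tau_G$ on $G\times G$, $\tau$ on $\overline{G}$) and the inverse mapping $G\to G$, $x\mapsto x^{-1}$, is continuous for $\tau_G$. *)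

theory Defs
  imports "HOL-Analysis.Analysis"
begin

definition upper_approx :: "'a set \<Rightarrow> 'a rel \<Rightarrow> 'a set \<Rightarrow> 'a set" where
  "upper_approx U R X = {x \<in> U. R `` {x} \<inter> X \<noteq> {}}"

locale approximation_space =
  fixes U :: "'a set" and R :: "'a rel"
  assumes nonempty: "U \<noteq> {}"
    and equiv: "equiv U R"

text \<open>As for monoids in the library, the rough identity element is a parameter of the locale; it
  is uniquely determined by the axioms (lemma \<open>rough_identity_unique\<close> below).\<close>

locale rough_group = approximation_space U R
  for U :: "'a set" and R :: "'a rel" +
  fixes mult :: "'a \<Rightarrow> 'a \<Rightarrow> 'a" (infixl \<open>\<odot>\<close> 70)
    and G :: "'a set"
    and e :: 'a
  assumes mult_closed: "\<lbrakk>x \<in> U; y \<in> U\<rbrakk> \<Longrightarrow> x \<odot> y \<in> U"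
    and subset: "G \<subseteq> U"
    and mult_upper: "\<lbrakk>x \<in> G; y \<in> G\<rbrakk> \<Longrightarrow> x \<odot> y \<in> upper_approx U R G"
    and assoc: "\<lbrakk>x \<in> upper_approx U R G; y \<in> upper_approx U R G; z \<in> upper_approx U R G\<rbrakk>
      \<Longrightarrow> (x \<odot> y) \<odot> z = x \<odot> (y \<odot> z)"
    and identity_upper: "e \<in> upper_approx U R G"
    and left_identity: "x \<in> upper_approx U R G \<Longrightarrow> e \<odot> x = x"
    and right_identity: "x \<in> upper_approx U R G \<Longrightarrow> x \<odot> e = x"
    and inverse_exists: "x \<in> G \<Longrightarrow> \<exists>y\<in>G. x \<odot> y = e \<and> y \<odot> x = e"
begin

definition rough_inverse :: "'a \<Rightarrow> 'a" where
  "rough_inverse x = (THE y. y \<in> G \<and> x \<odot> y = e \<and> y \<odot> x = e)"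

lemma subset_upper: "G \<subseteq> upper_approx U R G"
  using subset equiv unfolding upper_approx_def equiv_def refl_on_def by blast

lemma rough_identity_unique:
  assumes "e' \<in> upper_approx U R G"
    and "\<And>x. x \<in> upper_approx U R G \<Longrightarrow> e' \<odot> x = x"
  shows "e' = e"
  using assms identity_upper right_identity by metis

lemma inverse_ex1:
  assumes "x \<in> G"
  shows "\<exists>!y. y \<in> G \<and> x \<odot> y = e \<and> y \<odot> x = e"
proof -
  have "y = z" if "y \<in> G" "z \<in> G" "y \<odot> x = e" "x \<odot> z = e" for y z
    using that assms subset_upper assoc[of y x z] left_identity right_identity
    by (metis subsetD)
  then show ?thesis
    using inverse_exists[OF assms] by blast
qed

lemma rough_inverse:
  assumes "x \<in> G"
  shows "rough_inverse x \<in> G" "x \<odot> rough_inverse x = e" "rough_inverse x \<odot> x = e"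
  using theI'[OF inverse_ex1[OF assms]] unfolding rough_inverse_def by blast+

end

locale topological_rough_group = rough_group U R mult G e
  for U :: "'a set" and R :: "'a rel" and mult :: "'a \<Rightarrow> 'a \<Rightarrow> 'a" (infixl \<open>\<odot>\<close> 70)
    and G :: "'a set" and e :: 'a +
  fixes \<tau> :: "'a topology"
  assumes topspace_upper: "topspace \<tau> = upper_approx U R G"
    and continuous_mult:
      "continuous_map (prod_topology (subtopology \<tau> G) (subtopology \<tau> G)) \<tau> (\<lambda>(x, y). x \<odot> y)"
    and continuous_inverse:
      "continuous_map (subtopology \<tau> G) (subtopology \<tau> G) rough_inverse"

end

theory Submission
  imports Defs
begin

text \<open>If \<open>e\<close> lies in the closure of \<open>g\<close>, then inversion puts \<open>e\<close> in the closure of the inverse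
  of \<open>g\<close>, while right translation by the inverse of \<open>g\<close> puts that inverse in the closure of \<open>e\<close>.
  In a \<open>T\<^sub>0\<close>-space the inverse of \<open>g\<close> is then \<open>e\<close>, hence so is \<open>g\<close>.\<close>

text \<open>Each open set around one point contains the other, so no open set separates
  them.\<close>

lemma t0_space_closure_of_antisym:
  assumes "t0_space X" "x \<in> X closure_of {y}" "y \<in> X closure_of {x}"
  shows "x = y"
  using assms unfolding t0_space_def in_closure_of by (metis singletonD)

context topological_rough_group
begin

lemma topspace_subtopology_G: "topspace (subtopology \<tau> G) = G"
  using subset_upper topspace_upper by auto

text \<open>The codomain is \<open>\<tau>\<close>, not its subspace on \<open>G\<close>, because a
  product of elements of \<open>G\<close> may leave \<open>G\<close>.\<close>

lemma continuous_right_translation: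
  assumes "a \<in> G"
  shows "continuous_map (subtopology \<tau> G) \<tau> (\<lambda>x. x \<odot> a)"
proof -
  have "continuous_map (subtopology \<tau> G) (prod_topology (subtopology \<tau> G) (subtopology \<tau> G))
      (\<lambda>x. (x, a))"
    using assms topspace_subtopology_G by (intro continuous_map_pairedI) auto
  from continuous_map_compose[OF this continuous_mult] show ?thesis
    by (simp add: o_def)
qed

lemma closure_of_identity_trivial:
  assumes t0: "t0_space (subtopology \<tau> G)" and e: "e \<in> G" and g: "g \<in> G"
    and cl: "e \<in> subtopology \<tau> G closure_of {g}"
  shows "g = e"
proof -
  let ?h = "rough_inverse g"
  note h = rough_inverse[OF g]
  have inv_e: "rough_inverse e = e"
    using rough_inverse[OF e] left_identity subset_upper by (metis subsetD)
  have "rough_inverse e \<in> subtopology \<tau> G closure_of {?h}"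
    using continuous_map_image_closure_subset[OF continuous_inverse, of "{g}"] cl by auto
  then have 1: "e \<in> subtopology \<tau> G closure_of {?h}"
    by (simp add: inv_e)
  have "e \<odot> ?h \<in> \<tau> closure_of {g \<odot> ?h}"
    using continuous_map_image_closure_subset[OF continuous_right_translation[OF h(1)], of "{g}"] cl
    by auto
  moreover have "e \<odot> ?h = ?h"
    using left_identity h(1) subset_upper by blast
  \<comment> \<open>Here \<open>g \<odot> ?h = e\<close>. Since \<open>?h\<close> and
    \<open>e\<close> both lie in \<open>G\<close>, the closure in \<open>\<tau>\<close> can be cut
    down to \<open>G\<close>; this is where \<open>e \<in> G\<close> matters for the
    translation.\<close>
  ultimately have "?h \<in> subtopology \<tau> G closure_of {e}"
    using h e by (simp add: closure_of_subtopology)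
  with t0 1 have "e = ?h"
    by (rule t0_space_closure_of_antisym)
  then show ?thesis
    using h(2) right_identity g subset_upper by (metis subsetD)
qed

end

theorem proposition3p6:
  fixes U :: "'a set" and R :: "'a rel" and mult :: "'a \<Rightarrow> 'a \<Rightarrow> 'a"
    and G :: "'a set" and e :: 'a and \<tau> :: "'a topology"
  assumes "topological_rough_group U R mult G e \<tau>"
    and "t0_space (subtopology \<tau> G)"
    and "e \<in> G"
  shows "\<forall>g \<in> G - {e}. e \<notin> subtopology \<tau> G closure_of {g}"
  using topological_rough_group.closure_of_identity_trivial[OF assms] by blast

end
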